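(* Let $x,y\in\mathbb{R}^2$ with $0\le y_i\le x_i\le 1$ for $i=1,2$. Then $$\frac{y_1^2}{x_1}-x_2\le \frac{y_1^2}{x_1}+\frac{y_2^2}{x_2}-2\min\{y_1,y_2\}\quad\text{and}\quad \frac{y_2^2}{x_2}-x_1\le \frac{y_1^2}{x_1}+\frac{y_2^2}{x_2}-2\min\{y_1,y_2\}.$$ In other words, the inequality $\frac{y_1^2}{x_1}+\frac{y_2^2}{x_2}-2\min\{y_1,y_2\}\le t$ dominates both inequalities $\frac{y_1^2}{x_1}-x_2\le t$ and $\frac{y_2^2}{x_2}-x_1\le t$.
   Context: Convention for division by zero: $0/0=0$ and $a/0=\infty$ for $a>0$. *)

theory Defs
  imports "HOL-Analysis.Analysis"
begin

text \<open>Quotients are taken in the extended reals, whose division already follows the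
  convention 0 / 0 = 0 and a / 0 = \<infinity> for a > 0 (unlike division on the reals,
  where a / 0 = 0):\<close>

lemma ereal_zero_div_zero: "ereal 0 / ereal 0 = 0"
  by (simp add: divide_ereal_def flip: zero_ereal_def)

lemma ereal_pos_div_zero: "0 < a \<Longrightarrow> ereal a / ereal 0 = \<infinity>"
  by (simp add: divide_ereal_def flip: zero_ereal_def)

end

theory Submission imports Defs begin

text \<open>Dividing \<open>0 \<le> (x - y)\<^sup>2\<close> by \<open>x\<close> gives \<open>2 * y \<le> y\<^sup>2 / x + x\<close>, which is where the
  term \<open>- 2 * min y\<^sub>1 y\<^sub>2\<close> is absorbed. The hypotheses force \<open>y = 0\<close> whenever \<open>x = 0\<close>, so the
  infinite quotients never occur and everything takes place in the reals.\<close>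

lemma ereal_square_divide:
  assumes "0 \<le> y" "y \<le> x"
  shows "ereal (y\<^sup>2) / ereal x = ereal (y\<^sup>2 / x)"
  \<comment> \<open>For \<open>x = 0\<close> also \<open>y = 0\<close>: the left side is 0 by the
    convention, the right side by the real default \<open>a / 0 = 0\<close>.\<close>
  using assms by (cases "x = 0") (auto simp: ereal_zero_div_zero)

lemma two_mult_le_square_divide_add:
  fixes x y :: real
  assumes "0 \<le> y" "y \<le> x"
  shows "2 * y \<le> y\<^sup>2 / x + x"
proof (cases "x = 0")
  case False
  have "0 \<le> (x - y)\<^sup>2 / x"
    using assms by simp
  also have "(x - y)\<^sup>2 / x = y\<^sup>2 / x + x - 2 * y"
    using False by (simp add: field_simps power2_eq_square)
  finally show ?thesis by simp
\<comment> \<open>For \<open>x = 0\<close>, squeezing gives \<open>y = 0\<close>, so both sides are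
  0.\<close>
qed (use assms in simp)

theorem mainTheorem4:
  fixes x y :: "real ^ 2"
  assumes "\<forall>i. 0 \<le> y $ i \<and> y $ i \<le> x $ i \<and> x $ i \<le> 1"
  shows "(ereal ((y $ 1)\<^sup>2) / ereal (x $ 1) - ereal (x $ 2)
            \<le> ereal ((y $ 1)\<^sup>2) / ereal (x $ 1) + ereal ((y $ 2)\<^sup>2) / ereal (x $ 2)
               - ereal (2 * min (y $ 1) (y $ 2)))
       \<and> (ereal ((y $ 2)\<^sup>2) / ereal (x $ 2) - ereal (x $ 1)
            \<le> ereal ((y $ 1)\<^sup>2) / ereal (x $ 1) + ereal ((y $ 2)\<^sup>2) / ereal (x $ 2)
               - ereal (2 * min (y $ 1) (y $ 2)))
       \<and> (\<forall>t :: real.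
            ereal ((y $ 1)\<^sup>2) / ereal (x $ 1) + ereal ((y $ 2)\<^sup>2) / ereal (x $ 2)
               - ereal (2 * min (y $ 1) (y $ 2)) \<le> ereal t
            \<longrightarrow> ereal ((y $ 1)\<^sup>2) / ereal (x $ 1) - ereal (x $ 2) \<le> ereal t
              \<and> ereal ((y $ 2)\<^sup>2) / ereal (x $ 2) - ereal (x $ 1) \<le> ereal t)"
proof -
  have bounds: "0 \<le> y $ i" "y $ i \<le> x $ i" for i
    using assms by auto
  have q: "ereal ((y $ i)\<^sup>2) / ereal (x $ i) = ereal ((y $ i)\<^sup>2 / x $ i)" for i
    by (rule ereal_square_divide[OF bounds])
  have "2 * y $ i \<le> (y $ i)\<^sup>2 / x $ i + x $ i" for i
    by (rule two_mult_le_square_divide_add[OF bounds])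
  \<comment> \<open>Once the common quotient cancels, the first claim is the bound at index 2
    weakened by \<open>min (y $ 1) (y $ 2) \<le> y $ 2\<close>; the second is its mirror image at
    index 1, and the claim for \<open>t\<close> follows by transitivity.\<close>
  from this[of 1] this[of 2] show ?thesis
    unfolding q plus_ereal.simps ereal_minus(1) ereal_less_eq(3) by linarith
qed

end
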